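(* Let $\mathcal{X}\subseteq\mathbb{R}^d$ be a locally compact Hausdorff set, $H:\mathcal{X}\times\mathcal{X}\to\mathbb{R}$ a function, and $C=\{c_1,\dots,c_k\}\subset\mathcal{X}$ a finite set of centers such that the functions $H(\cdot,c_1),\dots,H(\cdot,c_k)$ are linearly independent over $\mathbb{R}$. For $1<p<\infty$, $p\neq2$, the space $(\ell_p^k,\|\cdot\|_{\ell_p^k})$ is a reproducing kernel Banach space on $\mathcal{X}$.
   Context: $\ell_p^k=\ell_p^k(C)=\left\{f_\alpha=\sum_{i=1}^k\alpha_iH(\cdot,c_i):\ \alpha\in\mathbb{R}^k\right\}$, a space of real-valued functions on $\mathcal{X}$, with norm $\|f_\alpha\|_{\ell_p^k}=\left(\sum_{i=1}^k|\alpha_i|^p\right)^{1/p}$ (well defined by linear independence). A reproducing kernel Banach space on a nonempty set $\mathcal{X}$ is a Banach space $\mathcal{B}$ of functions on $\mathcal{X}$ such that for every $x\in\mathcal{X}$ the point evaluation functional is continuous: there is $C_x\ge0$ with $|f(x)|\le C_x\|f\|_{\mathcal{B}}$ for all $f\in\mathcal{B}$. *)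

theory Defs
  imports "HOL-Analysis.Analysis"
begin

text \<open>
  A real-valued function on \<open>X\<close> is represented by an element of \<^term>\<open>extensional X\<close>, so that
  equality of representatives is equality on \<open>X\<close>. A normed space of functions on \<open>X\<close> is a
  carrier set \<open>B\<close> of such functions with the pointwise vector operations, together with a
  norm \<open>N\<close> of which only the values on \<open>B\<close> matter.
\<close>

definition normed_fun_space ::
    "'a set \<Rightarrow> ('a \<Rightarrow> real) set \<Rightarrow> (('a \<Rightarrow> real) \<Rightarrow> real) \<Rightarrow> bool" where
  "normed_fun_space X B N \<longleftrightarrow>
     B \<subseteq> extensional X \<and>
     (\<lambda>x\<in>X. 0) \<in> B \<and>
     (\<forall>f\<in>B. \<forall>g\<in>B. (\<lambda>x\<in>X. f x + g x) \<in> B) \<and>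
     (\<forall>a. \<forall>f\<in>B. (\<lambda>x\<in>X. a * f x) \<in> B) \<and>
     (\<forall>f\<in>B. 0 \<le> N f) \<and>
     (\<forall>f\<in>B. N f = 0 \<longleftrightarrow> f = (\<lambda>x\<in>X. 0)) \<and>
     (\<forall>a. \<forall>f\<in>B. N (\<lambda>x\<in>X. a * f x) = \<bar>a\<bar> * N f) \<and>
     (\<forall>f\<in>B. \<forall>g\<in>B. N (\<lambda>x\<in>X. f x + g x) \<le> N f + N g)"

text \<open>
  The value 0 off \<open>B\<close> only serves the locale \<^locale>\<open>Metric_space\<close>, which
  asks for nonnegativity and symmetry of the distance on the whole type.
\<close>

definition fun_dist ::
    "'a set \<Rightarrow> ('a \<Rightarrow> real) set \<Rightarrow> (('a \<Rightarrow> real) \<Rightarrow> real)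
      \<Rightarrow> ('a \<Rightarrow> real) \<Rightarrow> ('a \<Rightarrow> real) \<Rightarrow> real" where
  "fun_dist X B N f g = (if f \<in> B \<and> g \<in> B then N (\<lambda>x\<in>X. f x - g x) else 0)"

lemma normed_fun_space_diff:
  assumes "normed_fun_space X B N" "f \<in> B" "g \<in> B"
  shows "(\<lambda>x\<in>X. f x - g x) \<in> B"
proof -
  have "(\<lambda>x\<in>X. (-1) * g x) \<in> B"
    using assms unfolding normed_fun_space_def by blast
  then have "(\<lambda>x\<in>X. f x + (\<lambda>x\<in>X. (-1) * g x) x) \<in> B"
    using assms unfolding normed_fun_space_def by blast
  moreover have "(\<lambda>x\<in>X. f x + (\<lambda>x\<in>X. (-1) * g x) x) = (\<lambda>x\<in>X. f x - g x)"
    by (auto simp: restrict_def)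
  ultimately show ?thesis by simp
qed

lemma Metric_space_fun_dist:
  assumes B: "normed_fun_space X B N"
  shows "Metric_space B (fun_dist X B N)"
proof
  fix f g
  show "0 \<le> fun_dist X B N f g"
    using normed_fun_space_diff[OF B] B by (auto simp: fun_dist_def normed_fun_space_def)
  show "fun_dist X B N f g = fun_dist X B N g f"
  proof (cases "f \<in> B \<and> g \<in> B")
    case True
    then have "N (\<lambda>x\<in>X. (-1) * (\<lambda>x\<in>X. f x - g x) x) = \<bar>-1\<bar> * N (\<lambda>x\<in>X. f x - g x)"
      using normed_fun_space_diff[OF B] B unfolding normed_fun_space_def by blast
    moreover have "(\<lambda>x\<in>X. (-1) * (\<lambda>x\<in>X. f x - g x) x) = (\<lambda>x\<in>X. g x - f x)"
      by (auto simp: restrict_def)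
    ultimately show ?thesis using True by (simp add: fun_dist_def)
  qed (auto simp: fun_dist_def)
next
  fix f g assume fg: "f \<in> B" "g \<in> B"
  then have ext: "f \<in> extensional X" "g \<in> extensional X"
    using B by (auto simp: normed_fun_space_def)
  have "fun_dist X B N f g = 0 \<longleftrightarrow> (\<lambda>x\<in>X. f x - g x) = (\<lambda>x\<in>X. 0)"
    using fg normed_fun_space_diff[OF B] B by (simp add: fun_dist_def normed_fun_space_def)
  also have "\<dots> \<longleftrightarrow> (\<forall>x\<in>X. f x = g x)"
    by (auto simp: restrict_def fun_eq_iff)
  also have "\<dots> \<longleftrightarrow> f = g"
    using ext by (auto intro: extensionalityI)
  finally show "fun_dist X B N f g = 0 \<longleftrightarrow> f = g" .
next
  fix f g h assume fgh: "f \<in> B" "g \<in> B" "h \<in> B"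
  have "N (\<lambda>x\<in>X. (\<lambda>x\<in>X. f x - g x) x + (\<lambda>x\<in>X. g x - h x) x)
      \<le> N (\<lambda>x\<in>X. f x - g x) + N (\<lambda>x\<in>X. g x - h x)"
    using fgh normed_fun_space_diff[OF B] B unfolding normed_fun_space_def by blast
  moreover have "(\<lambda>x\<in>X. (\<lambda>x\<in>X. f x - g x) x + (\<lambda>x\<in>X. g x - h x) x) = (\<lambda>x\<in>X. f x - h x)"
    by (auto simp: restrict_def)
  ultimately show "fun_dist X B N f h \<le> fun_dist X B N f g + fun_dist X B N g h"
    using fgh by (simp add: fun_dist_def)
qed

definition banach_fun_space ::
    "'a set \<Rightarrow> ('a \<Rightarrow> real) set \<Rightarrow> (('a \<Rightarrow> real) \<Rightarrow> real) \<Rightarrow> bool" where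
  "banach_fun_space X B N \<longleftrightarrow>
     normed_fun_space X B N \<and> Metric_space.mcomplete B (fun_dist X B N)"

definition reproducing_kernel_banach_space ::
    "'a set \<Rightarrow> ('a \<Rightarrow> real) set \<Rightarrow> (('a \<Rightarrow> real) \<Rightarrow> real) \<Rightarrow> bool" where
  "reproducing_kernel_banach_space X B N \<longleftrightarrow>
     X \<noteq> {} \<and> banach_fun_space X B N \<and>
     (\<forall>x\<in>X. \<exists>K\<ge>0. \<forall>f\<in>B. \<bar>f x\<bar> \<le> K * N f)"

definition kernel_comb ::
    "'a set \<Rightarrow> ('a \<Rightarrow> 'a \<Rightarrow> real) \<Rightarrow> nat \<Rightarrow> (nat \<Rightarrow> 'a) \<Rightarrow> (nat \<Rightarrow> real) \<Rightarrow> 'a \<Rightarrow> real" where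
  "kernel_comb X H k c \<alpha> = (\<lambda>x\<in>X. \<Sum>i=1..k. \<alpha> i * H x (c i))"

text \<open>Linear independence of the family \<open>H(\<cdot>, c 1), \<dots>, H(\<cdot>, c k)\<close> of functions on \<open>X\<close>.\<close>

definition kernel_lin_indep ::
    "'a set \<Rightarrow> ('a \<Rightarrow> 'a \<Rightarrow> real) \<Rightarrow> nat \<Rightarrow> (nat \<Rightarrow> 'a) \<Rightarrow> bool" where
  "kernel_lin_indep X H k c \<longleftrightarrow>
     (\<forall>\<alpha>. kernel_comb X H k c \<alpha> = (\<lambda>x\<in>X. 0) \<longrightarrow> (\<forall>i\<in>{1..k}. \<alpha> i = 0))"

definition lp_space ::
    "'a set \<Rightarrow> ('a \<Rightarrow> 'a \<Rightarrow> real) \<Rightarrow> nat \<Rightarrow> (nat \<Rightarrow> 'a) \<Rightarrow> ('a \<Rightarrow> real) set" where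
  "lp_space X H k c = range (kernel_comb X H k c)"

text \<open>
  The description is well defined on \<^const>\<open>lp_space\<close> when the family is linearly independent;
  only the values of \<open>\<alpha>\<close> on \<open>{1..k}\<close> are relevant.
\<close>

definition lp_norm ::
    "real \<Rightarrow> 'a set \<Rightarrow> ('a \<Rightarrow> 'a \<Rightarrow> real) \<Rightarrow> nat \<Rightarrow> (nat \<Rightarrow> 'a) \<Rightarrow> ('a \<Rightarrow> real) \<Rightarrow> real" where
  "lp_norm p X H k c f =
     (THE r. \<exists>\<alpha>. f = kernel_comb X H k c \<alpha> \<and> r = (\<Sum>i=1..k. \<bar>\<alpha> i\<bar> powr p) powr (1 / p))"

lemma lp_norm_kernel_comb:
  assumes "kernel_lin_indep X H k c"
  shows "lp_norm p X H k c (kernel_comb X H k c \<alpha>) = (\<Sum>i=1..k. \<bar>\<alpha> i\<bar> powr p) powr (1 / p)"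
proof -
  have eq: "\<alpha> i = \<beta> i"
    if "kernel_comb X H k c \<alpha> = kernel_comb X H k c \<beta>" "i \<in> {1..k}" for \<beta> i
  proof -
    have "kernel_comb X H k c (\<lambda>i. \<alpha> i - \<beta> i) = (\<lambda>x\<in>X. 0)"
    proof
      fix x
      show "kernel_comb X H k c (\<lambda>i. \<alpha> i - \<beta> i) x = (\<lambda>x\<in>X. 0) x"
        using fun_cong[OF that(1), of x]
        by (simp add: kernel_comb_def left_diff_distrib sum_subtractf restrict_def split: if_splits)
    qed
    with assms that(2) show ?thesis
      unfolding kernel_lin_indep_def by force
  qed
  show ?thesis
    unfolding lp_norm_def
  proof (rule the_equality)
    fix r
    assume "\<exists>\<beta>. kernel_comb X H k c \<alpha> = kernel_comb X H k c \<beta> \<and>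
      r = (\<Sum>i=1..k. \<bar>\<beta> i\<bar> powr p) powr (1 / p)"
    then obtain \<beta> where b: "kernel_comb X H k c \<alpha> = kernel_comb X H k c \<beta>"
      and r: "r = (\<Sum>i=1..k. \<bar>\<beta> i\<bar> powr p) powr (1 / p)" by blast
    have "(\<Sum>i=1..k. \<bar>\<beta> i\<bar> powr p) = (\<Sum>i=1..k. \<bar>\<alpha> i\<bar> powr p)"
      using eq[OF b] by (intro sum.cong) auto
    with r show "r = (\<Sum>i=1..k. \<bar>\<alpha> i\<bar> powr p) powr (1 / p)" by simp
  qed blast
qed

end

theory Submission imports Defs begin

text \<open>
  The coefficient map carries \<^const>\<open>lp_space\<close> isometrically onto \<open>\<real>\<^sup>k\<close> with the \<open>p\<close>-norm. The triangle
  inequality is Minkowski's inequality, obtained from convexity of \<open>t \<mapsto> t powr p\<close>. Each coefficient is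
  bounded by the norm, so Cauchy sequences converge coefficientwise, and
  \<open>\<bar>f x\<bar> \<le> (\<Sum>i. \<bar>H x (c i)\<bar>) * \<parallel>f\<parallel>\<close>.
\<close>

text \<open>For positive endpoints this is \<open>powr_convex\<close>. If an endpoint is 0, the
  inequality reduces to \<open>(u * a) powr p \<le> u * a powr p\<close>, which holds because
  \<open>u powr p \<le> u\<close> for \<open>u\<close> in the unit interval and
  \<open>p \<ge> 1\<close>.\<close>

lemma convex_on_powr_nonneg:
  fixes p :: real
  assumes "1 \<le> p"
  shows "convex_on {0..} (\<lambda>x. x powr p)"
proof -
  have scale: "(u * a) powr p \<le> u * a powr p" if "0 \<le> u" "u \<le> 1" "0 \<le> a" for u a :: real
    using that assms powr_mono'[of 1 p u] by (simp add: powr_mult mult_right_mono)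
  have "((1 - t) * a + t * b) powr p \<le> (1 - t) * a powr p + t * b powr p"
    if t: "0 < t" "t < 1" and ab: "0 \<le> a" "0 \<le> b" for t a b :: real
  proof (cases "a = 0 \<or> b = 0")
    case True
    then show ?thesis
      using scale[of t b] scale[of "1 - t" a] t ab by auto
  next
    case False
    then show ?thesis
      using convex_onD[OF powr_convex[OF assms], of t a b] t ab by simp
  qed
  then show ?thesis
    by (intro convex_onI) auto
qed

lemma abs_le_powr_sum:
  fixes f :: "'i \<Rightarrow> real"
  assumes "finite I" "i \<in> I" "0 < p"
  shows "\<bar>f i\<bar> \<le> (\<Sum>i\<in>I. \<bar>f i\<bar> powr p) powr (1 / p)"
proof -
  have "\<bar>f i\<bar> = (\<bar>f i\<bar> powr p) powr (1 / p)"
    using assms by (simp add: powr_powr)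
  also have "\<dots> \<le> (\<Sum>i\<in>I. \<bar>f i\<bar> powr p) powr (1 / p)"
    using assms by (intro powr_mono2 member_le_sum) auto
  finally show ?thesis .
qed

text \<open>Divide both families by their norms \<open>A\<close> and \<open>B\<close>. Up to the
  factor \<open>A + B\<close>, the sum is then bounded by a convex combination of two families of
  unit norm, so termwise convexity of \<open>powr p\<close> suffices and no duality with a conjugate
  exponent enters.\<close>

lemma Minkowski_sum:
  fixes f g :: "'i \<Rightarrow> real"
  assumes "finite I" "1 \<le> p"
  shows "(\<Sum>i\<in>I. \<bar>f i + g i\<bar> powr p) powr (1 / p)
    \<le> (\<Sum>i\<in>I. \<bar>f i\<bar> powr p) powr (1 / p) + (\<Sum>i\<in>I. \<bar>g i\<bar> powr p) powr (1 / p)"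
proof -
  define A where "A = (\<Sum>i\<in>I. \<bar>f i\<bar> powr p) powr (1 / p)"
  define B where "B = (\<Sum>i\<in>I. \<bar>g i\<bar> powr p) powr (1 / p)"
  have A: "A powr p = (\<Sum>i\<in>I. \<bar>f i\<bar> powr p)" and B: "B powr p = (\<Sum>i\<in>I. \<bar>g i\<bar> powr p)"
    using assms by (simp_all add: A_def B_def powr_powr sum_nonneg)
  have fA: "\<bar>f i\<bar> \<le> A" and gB: "\<bar>g i\<bar> \<le> B" if "i \<in> I" for i
    using abs_le_powr_sum[of I i p] assms that by (simp_all add: A_def B_def)
  have nonneg: "0 \<le> A" "0 \<le> B"
    by (simp_all add: A_def B_def)
  show ?thesis
  \<comment> \<open>Normalising requires both norms to be positive. If one of them is 0, then
    \<open>fA\<close> or \<open>gB\<close> forces that family to vanish on \<open>I\<close>.\<close>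
  proof (cases "A = 0 \<or> B = 0")
    case True
    have "(\<forall>i\<in>I. f i = 0) \<or> (\<forall>i\<in>I. g i = 0)"
      using True fA gB by fastforce
    then show ?thesis
      by auto
  next
    case False
    then have pos: "0 < A" "0 < B"
      using nonneg by auto
    \<comment> \<open>The weights \<open>1 - t\<close> and \<open>t\<close> are the shares of
      \<open>A\<close> and \<open>B\<close> in \<open>A + B\<close>; they turn
      \<open>A * u + B * v\<close> into \<open>(A + B) * ((1 - t) * u + t * v)\<close>.\<close>
    define t where "t = B / (A + B)"
    have t: "0 \<le> t" "t \<le> 1" and At: "(A + B) * (1 - t) = A" and Bt: "(A + B) * t = B"
      using pos by (auto simp: t_def field_simps)
    have norm1: "(\<Sum>i\<in>I. (\<bar>f i\<bar> / A) powr p) = 1" "(\<Sum>i\<in>I. (\<bar>g i\<bar> / B) powr p) = 1"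
      using pos by (simp_all add: powr_divide flip: sum_divide_distrib A B)
    have "\<bar>f i + g i\<bar> powr p
        \<le> (A + B) powr p * ((1 - t) * (\<bar>f i\<bar> / A) powr p + t * (\<bar>g i\<bar> / B) powr p)" for i
    proof -
      have "\<bar>f i + g i\<bar> \<le> A * (\<bar>f i\<bar> / A) + B * (\<bar>g i\<bar> / B)"
        using pos by simp
      also have "\<dots> = (A + B) * ((1 - t) * (\<bar>f i\<bar> / A) + t * (\<bar>g i\<bar> / B))"
        by (simp only: distrib_left At Bt flip: mult.assoc)
      finally have "\<bar>f i + g i\<bar> powr p
          \<le> ((A + B) * ((1 - t) * (\<bar>f i\<bar> / A) + t * (\<bar>g i\<bar> / B))) powr p"
        using assms by (intro powr_mono2) auto
      also have "\<dots> = (A + B) powr p * ((1 - t) * (\<bar>f i\<bar> / A) + t * (\<bar>g i\<bar> / B)) powr p"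
        by (rule powr_mult)
      also have "\<dots> \<le> (A + B) powr p * ((1 - t) * (\<bar>f i\<bar> / A) powr p + t * (\<bar>g i\<bar> / B) powr p)"
        using convex_onD[OF convex_on_powr_nonneg[OF assms(2)], of t "\<bar>f i\<bar> / A" "\<bar>g i\<bar> / B"] t pos
        by (intro mult_left_mono) auto
      finally show ?thesis .
    qed
    then have "(\<Sum>i\<in>I. \<bar>f i + g i\<bar> powr p)
        \<le> (\<Sum>i\<in>I. (A + B) powr p * ((1 - t) * (\<bar>f i\<bar> / A) powr p + t * (\<bar>g i\<bar> / B) powr p))"
      by (intro sum_mono)
    \<comment> \<open>Both normalised sums equal 1, so the convex weights add up to 1.\<close>
    also have "\<dots> = (A + B) powr p"
      by (simp add: sum.distrib norm1 flip: sum_distrib_left)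
    finally have "(\<Sum>i\<in>I. \<bar>f i + g i\<bar> powr p) powr (1 / p) \<le> ((A + B) powr p) powr (1 / p)"
      using assms by (intro powr_mono2 sum_nonneg) auto
    also have "\<dots> = A + B"
      using assms pos by (simp add: powr_powr)
    finally show ?thesis
      by (simp add: A_def B_def)
  qed
qed

lemma kernel_comb_zero: "kernel_comb X H k c (\<lambda>i. 0) = (\<lambda>x\<in>X. 0)"
  by (simp add: kernel_comb_def)

lemma kernel_comb_add:
  "(\<lambda>x\<in>X. kernel_comb X H k c \<alpha> x + kernel_comb X H k c \<beta> x) = kernel_comb X H k c (\<lambda>i. \<alpha> i + \<beta> i)"
  by (auto simp: kernel_comb_def distrib_right sum.distrib)

lemma kernel_comb_diff:
  "(\<lambda>x\<in>X. kernel_comb X H k c \<alpha> x - kernel_comb X H k c \<beta> x) = kernel_comb X H k c (\<lambda>i. \<alpha> i - \<beta> i)"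
  by (auto simp: kernel_comb_def left_diff_distrib sum_subtractf)

lemma kernel_comb_scale:
  "(\<lambda>x\<in>X. a * kernel_comb X H k c \<alpha> x) = kernel_comb X H k c (\<lambda>i. a * \<alpha> i)"
  by (auto simp: kernel_comb_def sum_distrib_left mult.assoc)

text \<open>Linear independence makes each coefficient a functional of the function itself, here
  bounded with constant 1. Definiteness of the norm, completeness and the evaluation bound all rest
  on this.\<close>

lemma abs_coeff_le_lp_norm:
  assumes "kernel_lin_indep X H k c" "0 < p" "i \<in> {1..k}"
  shows "\<bar>\<alpha> i\<bar> \<le> lp_norm p X H k c (kernel_comb X H k c \<alpha>)"
  using abs_le_powr_sum[of "{1..k}" i p \<alpha>] assms by (simp add: lp_norm_kernel_comb)

lemma normed_fun_space_lp:
  assumes indep: "kernel_lin_indep X H k c" and p: "1 \<le> p"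
  shows "normed_fun_space X (lp_space X H k c) (lp_norm p X H k c)"
proof -
  \<comment> \<open>Both directions pass through the vanishing of all coefficients: from norm 0 by
    the coefficient bound, from the zero function by linear independence.\<close>
  have zero: "lp_norm p X H k c (kernel_comb X H k c \<alpha>) = 0
      \<longleftrightarrow> kernel_comb X H k c \<alpha> = (\<lambda>x\<in>X. 0)" for \<alpha>
  proof
    assume "lp_norm p X H k c (kernel_comb X H k c \<alpha>) = 0"
    then have "\<forall>i\<in>{1..k}. \<alpha> i = 0"
      using abs_coeff_le_lp_norm[OF indep, of p _ \<alpha>] p by force
    then show "kernel_comb X H k c \<alpha> = (\<lambda>x\<in>X. 0)"
      by (auto simp: kernel_comb_def)
  next
    assume "kernel_comb X H k c \<alpha> = (\<lambda>x\<in>X. 0)"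
    then have "\<forall>i\<in>{1..k}. \<alpha> i = 0"
      using indep by (simp add: kernel_lin_indep_def)
    then show "lp_norm p X H k c (kernel_comb X H k c \<alpha>) = 0"
      by (simp add: lp_norm_kernel_comb[OF indep])
  qed
  have scale: "lp_norm p X H k c (kernel_comb X H k c (\<lambda>i. a * \<alpha> i))
      = \<bar>a\<bar> * lp_norm p X H k c (kernel_comb X H k c \<alpha>)" for a \<alpha>
  proof -
    have "(\<Sum>i=1..k. \<bar>a * \<alpha> i\<bar> powr p) = \<bar>a\<bar> powr p * (\<Sum>i=1..k. \<bar>\<alpha> i\<bar> powr p)"
      by (simp add: abs_mult powr_mult sum_distrib_left)
    then show ?thesis
      using p by (simp add: lp_norm_kernel_comb[OF indep] powr_mult powr_powr sum_nonneg)
  qed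
  have triangle: "lp_norm p X H k c (kernel_comb X H k c (\<lambda>i. \<alpha> i + \<beta> i))
      \<le> lp_norm p X H k c (kernel_comb X H k c \<alpha>) + lp_norm p X H k c (kernel_comb X H k c \<beta>)"
    for \<alpha> \<beta>
    using Minkowski_sum[of "{1..k}" p \<alpha> \<beta>] p by (simp add: lp_norm_kernel_comb[OF indep])
  have "(\<lambda>x\<in>X. 0) \<in> lp_space X H k c"
    unfolding lp_space_def by (metis kernel_comb_zero rangeI)
  moreover have "lp_space X H k c \<subseteq> extensional X"
    by (auto simp: lp_space_def kernel_comb_def)
  ultimately show ?thesis
    unfolding normed_fun_space_def
    using zero scale triangle
    by (auto simp: lp_space_def kernel_comb_add kernel_comb_scale lp_norm_kernel_comb[OF indep])
qed

lemma banach_fun_space_lp: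
  assumes indep: "kernel_lin_indep X H k c" and p: "1 \<le> p"
  shows "banach_fun_space X (lp_space X H k c) (lp_norm p X H k c)"
proof -
  let ?comb = "kernel_comb X H k c"
  let ?N = "lp_norm p X H k c"
  let ?B = "lp_space X H k c"
  let ?d = "fun_dist X ?B ?N"
  interpret Metric_space ?B ?d
    using normed_fun_space_lp[OF assms] by (rule Metric_space_fun_dist)
  have dist: "?d (?comb \<alpha>) (?comb \<beta>) = ?N (?comb (\<lambda>i. \<alpha> i - \<beta> i))" for \<alpha> \<beta>
    by (simp add: fun_dist_def lp_space_def kernel_comb_diff)
  have mcomplete
    unfolding mcomplete_def
  proof (intro allI impI)
    fix \<sigma>
    assume \<sigma>: "MCauchy \<sigma>"
    then have "range \<sigma> \<subseteq> ?B"
      by (simp add: MCauchy_def)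
    then have "\<forall>n. \<exists>\<alpha>. \<sigma> n = ?comb \<alpha>"
      by (auto simp: lp_space_def)
    then obtain \<alpha> where \<alpha>: "\<And>n. \<sigma> n = ?comb (\<alpha> n)"
      by metis
    \<comment> \<open>Coefficients are 1-Lipschitz for \<open>?d\<close>, so each coordinate
      inherits the Cauchy property and completeness of the reals applies.\<close>
    have "convergent (\<lambda>n. \<alpha> n i)" if i: "i \<in> {1..k}" for i
    proof (rule real_Cauchy_convergent, rule CauchyI)
      fix e :: real
      assume "0 < e"
      then obtain M where M: "\<And>m n. M \<le> m \<Longrightarrow> M \<le> n \<Longrightarrow> ?d (\<sigma> m) (\<sigma> n) < e"
        using \<sigma> unfolding MCauchy_def by blast
      have "\<bar>\<alpha> m i - \<alpha> n i\<bar> \<le> ?d (\<sigma> m) (\<sigma> n)" for m n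
        using abs_coeff_le_lp_norm[OF indep _ i, of p "\<lambda>i. \<alpha> m i - \<alpha> n i"] p
        by (simp add: \<alpha> dist)
      then show "\<exists>M. \<forall>m\<ge>M. \<forall>n\<ge>M. norm (\<alpha> m i - \<alpha> n i) < e"
        using M by (metis order.strict_trans1 real_norm_def)
    qed
    \<comment> \<open>Values of \<open>\<beta>\<close> outside \<open>{1..k}\<close> are arbitrary;
      they affect neither \<open>?comb \<beta>\<close> nor its norm.\<close>
    then obtain \<beta> where \<beta>: "\<And>i. i \<in> {1..k} \<Longrightarrow> (\<lambda>n. \<alpha> n i) \<longlonglongrightarrow> \<beta> i"
      unfolding convergent_def by metis
    \<comment> \<open>Coordinatewise convergence gives norm convergence because the sum is finite.
      The limits are taken at base 0, where \<open>tendsto_powr'\<close> asks for a positive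
      exponent and nonnegative bases; \<open>0 powr p\<close> is 0.\<close>
    have "(\<lambda>n. (\<Sum>i=1..k. \<bar>\<alpha> n i - \<beta> i\<bar> powr p)) \<longlonglongrightarrow> (\<Sum>i=1..k. 0 powr p)"
    proof (rule tendsto_sum)
      fix i
      assume "i \<in> {1..k}"
      from \<beta>[OF this] have "(\<lambda>n. \<bar>\<alpha> n i - \<beta> i\<bar>) \<longlonglongrightarrow> 0"
        by (simp add: tendsto_rabs_zero_iff LIM_zero_iff)
      then show "(\<lambda>n. \<bar>\<alpha> n i - \<beta> i\<bar> powr p) \<longlonglongrightarrow> 0 powr p"
        using p by (intro tendsto_powr') auto
    qed
    then have "(\<lambda>n. (\<Sum>i=1..k. \<bar>\<alpha> n i - \<beta> i\<bar> powr p) powr (1 / p)) \<longlonglongrightarrow> 0 powr (1 / p)"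
      using p by (intro tendsto_powr') (auto intro!: always_eventually sum_nonneg)
    then have "(\<lambda>n. ?d (\<sigma> n) (?comb \<beta>)) \<longlonglongrightarrow> 0"
      by (simp add: \<alpha> dist lp_norm_kernel_comb[OF indep])
    moreover have "\<And>n. \<sigma> n \<in> ?B" "?comb \<beta> \<in> ?B"
      by (auto simp: \<alpha> lp_space_def)
    ultimately have "limitin mtopology \<sigma> (?comb \<beta>) sequentially"
      by (simp add: limitin_metric_dist_null)
    then show "\<exists>f. limitin mtopology \<sigma> f sequentially"
      by blast
  qed
  then show ?thesis
    using normed_fun_space_lp[OF assms] by (simp add: banach_fun_space_def)
qed

text \<open>Each coefficient is replaced by the full norm, which leaves a constant depending on
  \<open>x\<close> and the centers but not on \<open>f\<close>. It is not claimed to be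
  sharp.\<close>

lemma lp_evaluation_bound:
  assumes indep: "kernel_lin_indep X H k c" and p: "0 < p" and f: "f \<in> lp_space X H k c" and "x \<in> X"
  shows "\<bar>f x\<bar> \<le> (\<Sum>i=1..k. \<bar>H x (c i)\<bar>) * lp_norm p X H k c f"
proof -
  obtain \<alpha> where \<alpha>: "f = kernel_comb X H k c \<alpha>"
    using f by (auto simp: lp_space_def)
  have "\<bar>f x\<bar> \<le> (\<Sum>i=1..k. \<bar>\<alpha> i * H x (c i)\<bar>)"
    using \<open>x \<in> X\<close> by (simp add: \<alpha> kernel_comb_def sum_abs)
  also have "\<dots> \<le> (\<Sum>i=1..k. \<bar>H x (c i)\<bar> * lp_norm p X H k c f)"
    using abs_coeff_le_lp_norm[OF indep p, of _ \<alpha>]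
    by (intro sum_mono) (simp add: \<alpha> abs_mult mult.commute[of "\<bar>\<alpha> _\<bar>"] mult_left_mono)
  finally show ?thesis
    by (simp add: sum_distrib_right)
qed

theorem lemma28:
  fixes X :: "(real ^ 'd) set"
    and H :: "real ^ 'd \<Rightarrow> real ^ 'd \<Rightarrow> real"
    and c :: "nat \<Rightarrow> real ^ 'd"
    and k :: nat
    and p :: real
  assumes "X \<noteq> {}"
    and "locally_compact_space (top_of_set X)"
    and "Hausdorff_space (top_of_set X)"
    and "\<And>i. i \<in> {1..k} \<Longrightarrow> c i \<in> X"
    and "kernel_lin_indep X H k c"
    and "1 < p" and "p \<noteq> 2"
  shows "reproducing_kernel_banach_space X (lp_space X H k c) (lp_norm p X H k c)"
  unfolding reproducing_kernel_banach_space_def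
proof (intro conjI ballI)
  show "X \<noteq> {}"
    by fact
  show "banach_fun_space X (lp_space X H k c) (lp_norm p X H k c)"
    using assms by (intro banach_fun_space_lp) auto
next
  fix x
  assume "x \<in> X"
  \<comment> \<open>For \<open>k = 0\<close> the witness is the empty sum 0, in accordance with a
    space that contains only the zero function.\<close>
  then show "\<exists>K\<ge>0. \<forall>f\<in>lp_space X H k c. \<bar>f x\<bar> \<le> K * lp_norm p X H k c f"
    using lp_evaluation_bound[of X H k c p _ x] assms
    by (intro exI[of _ "\<Sum>i=1..k. \<bar>H x (c i)\<bar>"]) (auto intro: sum_nonneg)
qed

end
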